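(* For any finite tree $G$ and any finite graph $H$, \[\gamma_{gr}(G\boxtimes H)=\gamma_{gr}(G)\,\gamma_{gr}(H).\]
   Context: For a graph $G$, a sequence of vertices $S=(v_1,\dots,v_k)$ is a legal sequence if for every $i\in[k]$, $N[v_i]\setminus\bigcup_{j=1}^{i-1}N[v_j]\neq\emptyset$ ($N[v]$ the closed neighborhood). The Grundy domination number $\gamma_{gr}(G)$ is the maximum length of a legal sequence of $G$. The strong product $G\boxtimes H$ has vertex set $V(G)\times V(H)$, and $(g_1,h_1)$, $(g_2,h_2)$ are adjacent iff either $g_1=g_2$ and $h_1h_2\in E(H)$, or $g_1g_2\in E(G)$ and $h_1=h_2$, or $g_1g_2\in E(G)$ and $h_1h_2\in E(H)$. *)

theory Defs
  imports "Graph_Theory.Graph_Theory"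
begin

text \<open>
  A finite simple graph is a \<^const>\<open>pair_graph\<close>: finite vertex set, symmetric irreflexive arc
  relation.  The library predicate \<^const>\<open>tree\<close> cannot be used for such graphs: in a
  symmetric digraph it counts the closed walk \<open>u, v, u\<close> along an edge as a cycle.  A cycle
  of an undirected graph is a library cycle with at least three arcs.
\<close>

definition undirected_tree :: "'a pair_pre_digraph \<Rightarrow> bool" where
  "undirected_tree G \<longleftrightarrow>
     Digraph_Component.connected (with_proj G) \<and>
     \<not> (\<exists>p. pre_digraph.cycle (with_proj G) p \<and> 3 \<le> length p)"

definition closed_nbhd :: "'a pair_pre_digraph \<Rightarrow> 'a \<Rightarrow> 'a set" where
  "closed_nbhd G v = insert v {u. (v, u) \<in> parcs G}"

definition legal_seq :: "'a pair_pre_digraph \<Rightarrow> 'a list \<Rightarrow> bool" where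
  "legal_seq G S \<longleftrightarrow> set S \<subseteq> pverts G \<and>
     (\<forall>i < length S. closed_nbhd G (S ! i) - (\<Union>j<i. closed_nbhd G (S ! j)) \<noteq> {})"

definition grundy_dom_number :: "'a pair_pre_digraph \<Rightarrow> nat" where
  "grundy_dom_number G = Max {length S | S. legal_seq G S}"

definition strong_product ::
    "'a pair_pre_digraph \<Rightarrow> 'b pair_pre_digraph \<Rightarrow> ('a \<times> 'b) pair_pre_digraph" where
  "strong_product G H = \<lparr> pverts = pverts G \<times> pverts H,
     parcs = {((g1, h1), (g2, h2)) | g1 h1 g2 h2.
       (g1, h1) \<in> pverts G \<times> pverts H \<and> (g2, h2) \<in> pverts G \<times> pverts H \<and>
       (g1 = g2 \<and> (h1, h2) \<in> parcs H \<or>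
        (g1, g2) \<in> parcs G \<and> h1 = h2 \<or>
        (g1, g2) \<in> parcs G \<and> (h1, h2) \<in> parcs H)} \<rparr>"

lemma legal_seq_distinct:
  assumes "legal_seq G S"
  shows "distinct S"
proof -
  have "S ! i \<noteq> S ! j" if "i < length S" "j < i" for i j
    using assms that unfolding legal_seq_def by fastforce
  then show ?thesis
    unfolding distinct_conv_nth by (metis nat_neq_iff)
qed

text \<open>The maximum defining \<^const>\<open>grundy_dom_number\<close> is over a finite nonempty set.\<close>

lemma finite_legal_seq_lengths:
  assumes "pair_graph G"
  shows "finite {length S | S. legal_seq G S}" "{length S | S. legal_seq G S} \<noteq> {}"
proof -
  interpret pair_graph G by fact
  have "length S \<le> card (pverts G)" if "legal_seq G S" for S
    using that legal_seq_distinct[OF that] card_mono[OF pair_finite_verts, of "set S"]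
    by (simp add: legal_seq_def distinct_card)
  then have "{length S | S. legal_seq G S} \<subseteq> {..card (pverts G)}" by auto
  then show "finite {length S | S. legal_seq G S}" by (rule finite_subset) simp
  have "legal_seq G []" by (simp add: legal_seq_def)
  then show "{length S | S. legal_seq G S} \<noteq> {}" by blast
qed

lemma pair_graph_strong_product:
  assumes "pair_graph G" "pair_graph H"
  shows "pair_graph (strong_product G H)"
proof -
  interpret G: pair_graph G by fact
  interpret H: pair_graph H by fact
  have sub: "parcs (strong_product G H) \<subseteq> (pverts G \<times> pverts H) \<times> (pverts G \<times> pverts H)"
    by (auto simp: strong_product_def)
  have fin: "finite (pverts G \<times> pverts H)"
    using G.pair_finite_verts H.pair_finite_verts by simp
  have symG: "(v, u) \<in> parcs G" if "(u, v) \<in> parcs G" for u v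
    using G.pair_sym_arcs that by (auto simp: symmetric_def sym_def)
  have symH: "(v, u) \<in> parcs H" if "(u, v) \<in> parcs H" for u v
    using H.pair_sym_arcs that by (auto simp: symmetric_def sym_def)
  show ?thesis
  proof
    show "finite (parcs (strong_product G H))"
      using sub fin by (meson finite_SigmaI finite_subset)
    show "finite (pverts (strong_product G H))"
      using fin by (simp add: strong_product_def)
    show "symmetric (with_proj (strong_product G H))"
      by (auto simp: symmetric_def sym_def strong_product_def intro: symG symH)
    show "fst e \<noteq> snd e" if "e \<in> parcs (strong_product G H)" for e
      using that G.pair_no_loops H.pair_no_loops by (fastforce simp: strong_product_def)
  qed (auto simp: strong_product_def)
qed

end

theory Submission
  imports Defs
begin

text \<open>
  A legal sequence together with a choice of footprints is a triangular submatrix of the closed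
  neighbourhood matrix, and the closed neighbourhood matrix of \<open>G \<boxtimes> H\<close> is a Kronecker product.
  Ordering products of moves lexicographically gives the lower bound.  For the upper bound, if the
  entries of the matrix of \<open>G\<close> are covered by \<open>k\<close> all-ones blocks (bicliques), then the moves of a
  legal sequence of \<open>G \<boxtimes> H\<close> falling into one block project to a legal sequence of \<open>H\<close>, so its length
  is at most \<open>k * \<gamma>\<^sub>g\<^sub>r H\<close>.  It remains to see that every forest has a block cover with as many
  blocks as some legal sequence has moves.  This holds by induction: near the end of a
  longest path one finds one of a few local configurations whose removal lowers both numbers
  by the same amount.
\<close>

section \<open>Triangular sequences and biclique covers\<close>

text \<open>A legal sequence with chosen footprints: each pair is a move and a vertex that it newly
  dominates. Deleting vertices shrinks only \<open>V\<close>, while \<open>R\<close> stays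
  fixed.\<close>

definition triangular :: "('a \<Rightarrow> 'a \<Rightarrow> bool) \<Rightarrow> 'a set \<Rightarrow> ('a \<times> 'a) list \<Rightarrow> bool" where
  "triangular R V ps \<longleftrightarrow> (\<forall>(v, u) \<in> set ps. v \<in> V \<and> u \<in> V \<and> R v u) \<and>
     sorted_wrt (\<lambda>p q. \<not> R (fst p) (snd q)) ps"

definition rows :: "('a \<times> 'b) list \<Rightarrow> 'a set" where
  "rows ps = fst ` set ps"

definition cols :: "('a \<times> 'b) list \<Rightarrow> 'b set" where
  "cols ps = snd ` set ps"

lemma rows_simps [simp]:
  "rows [] = {}" "rows ((v, u) # ps) = insert v (rows ps)" "rows (ps @ qs) = rows ps \<union> rows qs"
  by (auto simp: rows_def)

lemma cols_simps [simp]: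
  "cols [] = {}" "cols ((v, u) # ps) = insert u (cols ps)" "cols (ps @ qs) = cols ps \<union> cols qs"
  by (auto simp: cols_def)

lemma triangular_Nil [simp]: "triangular R V []"
  by (simp add: triangular_def)

lemma triangular_Cons [simp]:
  "triangular R V ((v, u) # ps) \<longleftrightarrow>
     v \<in> V \<and> u \<in> V \<and> R v u \<and> (\<forall>u' \<in> cols ps. \<not> R v u') \<and> triangular R V ps"
  by (auto simp: triangular_def cols_def)

lemma triangular_append [simp]:
  "triangular R V (xs @ ys) \<longleftrightarrow>
     triangular R V xs \<and> triangular R V ys \<and> (\<forall>v \<in> rows xs. \<forall>u \<in> cols ys. \<not> R v u)"
  by (auto simp: triangular_def sorted_wrt_append rows_def cols_def)

lemma triangular_subset:
  assumes "triangular R V ps"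
  shows "rows ps \<subseteq> V" "cols ps \<subseteq> V"
  using assms by (auto simp: triangular_def rows_def cols_def)

lemma triangular_mono: "triangular R W ps \<Longrightarrow> W \<subseteq> V \<Longrightarrow> triangular R V ps"
  by (auto simp: triangular_def)

text \<open>The two sides index rows and columns of the matrix; they may overlap or differ, and they
  need not lie inside the current vertex set.\<close>

definition biclique :: "('a \<Rightarrow> 'a \<Rightarrow> bool) \<Rightarrow> 'a set \<times> 'a set \<Rightarrow> bool" where
  "biclique R K \<longleftrightarrow> (\<forall>a \<in> fst K. \<forall>b \<in> snd K. R a b)"

definition biclique_cover :: "('a \<Rightarrow> 'a \<Rightarrow> bool) \<Rightarrow> 'a set \<Rightarrow> ('a set \<times> 'a set) set \<Rightarrow> bool" where
  "biclique_cover R V C \<longleftrightarrow> finite C \<and> (\<forall>K \<in> C. biclique R K) \<and>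
     (\<forall>a \<in> V. \<forall>b \<in> V. R a b \<longrightarrow> (\<exists>K \<in> C. a \<in> fst K \<and> b \<in> snd K))"

text \<open>Two pairs of a triangular list never lie in one biclique, so every cover has at least
  \<open>length ps\<close> blocks; \<open>balanced\<close> says that the two optima meet.\<close>

definition balanced :: "('a \<Rightarrow> 'a \<Rightarrow> bool) \<Rightarrow> 'a set \<Rightarrow> bool" where
  "balanced R V \<longleftrightarrow> (\<exists>ps C. triangular R V ps \<and> biclique_cover R V C \<and> card C \<le> length ps)"

lemma balanced_empty: "balanced R {}"
  unfolding balanced_def
  by (intro exI[of _ "[]"] exI[of _ "{}"]) (simp add: triangular_def biclique_cover_def)

text \<open>The induction step in general form: the blocks in \<open>D\<close> need to cover only
  entries outside \<open>W \<times> W\<close>, and each must be paid for by one more pair. The new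
  list may rearrange \<open>ps\<close> freely.\<close>

lemma balanced_extend:
  assumes "balanced R W"
    and ext: "\<And>ps. triangular R W ps \<Longrightarrow> \<exists>ps'. triangular R V ps' \<and> length ps + length D \<le> length ps'"
    and bic: "\<And>K. K \<in> set D \<Longrightarrow> biclique R K"
    and cov: "\<And>a b. a \<in> V \<Longrightarrow> b \<in> V \<Longrightarrow> R a b \<Longrightarrow> a \<notin> W \<or> b \<notin> W \<Longrightarrow>
                \<exists>K \<in> set D. a \<in> fst K \<and> b \<in> snd K"
  shows "balanced R V"
proof -
  obtain ps C where ps: "triangular R W ps" and C: "biclique_cover R W C" and le: "card C \<le> length ps"
    using assms(1) unfolding balanced_def by blast
  obtain ps' where ps': "triangular R V ps'" "length ps + length D \<le> length ps'"
    using ext[OF ps] by blast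
  have "biclique_cover R V (C \<union> set D)"
    unfolding biclique_cover_def
  proof (intro conjI ballI impI)
    fix a b assume "a \<in> V" "b \<in> V" "R a b"
    then show "\<exists>K\<in>C \<union> set D. a \<in> fst K \<and> b \<in> snd K"
      using C cov[of a b] unfolding biclique_cover_def by blast
  qed (use C bic in \<open>auto simp: biclique_cover_def\<close>)
  moreover have "card (C \<union> set D) \<le> length ps'"
    using card_Un_le[of C "set D"] card_length[of D] le ps' by linarith
  ultimately show ?thesis unfolding balanced_def using ps' by blast
qed

locale closed_adjacency =
  fixes R :: "'a \<Rightarrow> 'a \<Rightarrow> bool"
  assumes R_refl [simp]: "R x x" and R_sym: "R x y \<Longrightarrow> R y x"
begin

text \<open>A move cannot recur: the footprint of its second occurrence would already be dominated
  by the first.\<close>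

lemma triangular_split_row:
  assumes "triangular R V ps" "s \<in> rows ps"
  obtains xs z ys where "ps = xs @ (s, z) # ys" "s \<notin> rows xs" "s \<notin> rows ys"
proof -
  obtain z where "(s, z) \<in> set ps" using assms(2) by (force simp: rows_def)
  then obtain xs ys where ps: "ps = xs @ (s, z) # ys" by (meson split_list)
  have "s \<notin> rows xs" "s \<notin> rows ys"
    using assms(1) unfolding triangular_def ps by (fastforce simp: rows_def sorted_wrt_append)+
  then show thesis using that ps by blast
qed

section \<open>Removable local configurations\<close>

lemma balanced_isolated:
  assumes "balanced R (V - {v})" "v \<in> V" and N: "\<And>u. u \<in> V \<Longrightarrow> R v u \<Longrightarrow> u = v"
  shows "balanced R V"
proof (rule balanced_extend[OF assms(1), where D = "[({v}, {v})]"])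
  fix ps assume t: "triangular R (V - {v}) ps"
  have "triangular R V (ps @ [(v, v)])"
    using triangular_mono[OF t] triangular_subset[OF t] assms(2) N R_sym by auto
  then show "\<exists>ps'. triangular R V ps' \<and> length ps + length [({v}, {v})] \<le> length ps'" by fastforce
qed (use N R_sym in \<open>auto simp: biclique_def\<close>)

text \<open>The component \<open>{l, s}\<close> is a single all-ones block, and playing
  \<open>l\<close> alone dominates it.\<close>

lemma balanced_isolated_edge:
  assumes "balanced R (V - {l, s})" "l \<in> V" "s \<in> V" "R l s"
    and Nl: "\<And>u. u \<in> V \<Longrightarrow> R l u \<Longrightarrow> u = l \<or> u = s"
    and Ns: "\<And>u. u \<in> V \<Longrightarrow> R s u \<Longrightarrow> u = l \<or> u = s"
  shows "balanced R V"
proof (rule balanced_extend[OF assms(1), where D = "[({l, s}, {l, s})]"])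
  fix ps assume t: "triangular R (V - {l, s}) ps"
  have "\<forall>v \<in> rows ps. \<not> R v l"
    using triangular_subset[OF t] Nl R_sym by blast
  then have "triangular R V (ps @ [(l, l)])"
    using triangular_mono[OF t] assms(2) by auto
  then show "\<exists>ps'. triangular R V ps' \<and> length ps + length [({l, s}, {l, s})] \<le> length ps'" by fastforce
next
  show "\<exists>K\<in>set [({l, s}, {l, s})]. a \<in> fst K \<and> b \<in> snd K"
    if "a \<in> V" "b \<in> V" "R a b" "a \<notin> V - {l, s} \<or> b \<notin> V - {l, s}" for a b
    using that Nl[of a] Nl[of b] Ns[of a] Ns[of b] R_sym[of a b] by auto
qed (use assms(4) R_sym[OF assms(4)] in \<open>auto simp: biclique_def\<close>)

text \<open>A leaf \<open>l\<close> hanging off \<open>s\<close> can be played immediately before \<open>s\<close>, unless \<open>s\<close> footprints only itself.\<close>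

lemma triangular_insert_leaf:
  assumes t: "triangular R (V - {l}) ps" and "l \<in> V" "s \<in> V" "l \<noteq> s"
    and Nl: "\<And>u. u \<in> V \<Longrightarrow> R l u \<Longrightarrow> u = l \<or> u = s"
    and self: "\<And>xs ys. ps = xs @ (s, s) # ys \<Longrightarrow> s \<notin> rows xs \<Longrightarrow>
          (\<exists>z. z \<notin> {l, s} \<and> triangular R V (xs @ (s, z) # ys)) \<or>
          (\<exists>ps'. triangular R V ps' \<and> length ps' = Suc (length ps))"
  shows "\<exists>ps'. triangular R V ps' \<and> length ps' = Suc (length ps)"
proof (cases "s \<in> rows ps")
  \<comment> \<open>Only \<open>l\<close> and \<open>s\<close> dominate \<open>l\<close>, and
    neither is played, so \<open>l\<close> can be appended.\<close>
  case False
  have "\<forall>v \<in> rows ps. \<not> R v l"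
    using triangular_subset[OF t] Nl R_sym False by blast
  then have "triangular R V (ps @ [(l, l)])"
    using triangular_mono[OF t] assms(2) by auto
  then show ?thesis by fastforce
next
  case True
  then obtain xs z ys where ps: "ps = xs @ (s, z) # ys" and xs: "s \<notin> rows xs"
    using triangular_split_row[OF t] by metis
  have tV: "triangular R V ps" and sub: "rows ps \<subseteq> V - {l}" "cols ps \<subseteq> V - {l}"
    using triangular_mono[OF t] triangular_subset[OF t] by auto
  show ?thesis
  proof (rule ccontr)
    assume no: "\<not> ?thesis"
    \<comment> \<open>Give \<open>s\<close> a footprint outside \<open>{l, s}\<close>. Then
      \<open>(l, l)\<close> fits right before \<open>s\<close>: earlier moves miss \<open>l\<close>,
      and later footprints, being missed by \<open>s\<close>, differ from \<open>s\<close>.\<close>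
    obtain z' where z': "z' \<notin> {l, s}" "triangular R V (xs @ (s, z') # ys)"
    proof (cases "z = s")
      case True
      then show thesis using self[of xs ys] ps xs no that by blast
    next
      case False
      then show thesis using that[of z] tV sub(2) unfolding ps by auto
    qed
    have "\<forall>v \<in> rows xs. \<not> R v l"
    proof -
      have "rows xs \<subseteq> V - {l}" using sub(1) unfolding ps by auto
      then show ?thesis using Nl R_sym xs by blast
    qed
    moreover have "\<forall>u \<in> cols ys. \<not> R l u"
    proof -
      have "\<forall>u \<in> cols ys. \<not> R s u" "cols ys \<subseteq> V - {l}" using tV sub(2) unfolding ps by auto
      then show ?thesis using Nl R_refl by blast
    qed
    moreover have "\<not> R l z'" using Nl z' by auto
    ultimately have "triangular R V (xs @ (l, l) # (s, z') # ys)"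
      using z' assms(2) by simp
    then show False using no unfolding ps by fastforce
  qed
qed

text \<open>One block on \<open>{l, s}\<close> covers the whole row and column of \<open>l\<close>,
  so a single additional pair suffices.\<close>

lemma balanced_leaf:
  assumes "balanced R (V - {l})" "R l s"
    and Nl: "\<And>u. u \<in> V \<Longrightarrow> R l u \<Longrightarrow> u = l \<or> u = s"
    and ext: "\<And>ps. triangular R (V - {l}) ps \<Longrightarrow> \<exists>ps'. triangular R V ps' \<and> length ps' = Suc (length ps)"
  shows "balanced R V"
proof (rule balanced_extend[OF assms(1), where D = "[({l, s}, {l, s})]"])
  show "\<exists>K\<in>set [({l, s}, {l, s})]. a \<in> fst K \<and> b \<in> snd K"
    if "a \<in> V" "b \<in> V" "R a b" "a \<notin> V - {l} \<or> b \<notin> V - {l}" for a b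
    using that Nl[of a] Nl[of b] R_sym[of a b] by auto
  show "\<exists>ps'. triangular R V ps' \<and> length ps + length [({l, s}, {l, s})] \<le> length ps'"
    if "triangular R (V - {l}) ps" for ps
    using ext[OF that] by fastforce
qed (use assms(2) R_sym[OF assms(2)] in \<open>auto simp: biclique_def\<close>)

text \<open>If \<open>s\<close> footprints itself, then neither \<open>s\<close> nor its other leaf
  \<open>l'\<close> was played before. So \<open>l'\<close> is undominated too and can replace
  \<open>s\<close> as footprint, which makes room for \<open>l\<close>.\<close>

lemma balanced_twin_leaves:
  assumes "balanced R (V - {l})" "l \<in> V" "l' \<in> V" "s \<in> V" "distinct [l, l', s]" "R l s" "R l' s"
    and Nl: "\<And>u. u \<in> V \<Longrightarrow> R l u \<Longrightarrow> u = l \<or> u = s"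
    and Nl': "\<And>u. u \<in> V \<Longrightarrow> R l' u \<Longrightarrow> u = l' \<or> u = s"
  shows "balanced R V"
proof (rule balanced_leaf[OF assms(1,6) Nl])
  fix ps assume t: "triangular R (V - {l}) ps"
  have tV: "triangular R V ps" and sub: "rows ps \<subseteq> V - {l}"
    using triangular_mono[OF t] triangular_subset[OF t] by auto
  show "\<exists>ps'. triangular R V ps' \<and> length ps' = Suc (length ps)"
  proof (rule triangular_insert_leaf[OF t _ _ _ Nl])
    fix xs ys assume ps: "ps = xs @ (s, s) # ys" and xs: "s \<notin> rows xs"
    have "\<forall>v \<in> rows xs. \<not> R v l'"
    proof (intro ballI notI)
      fix v assume v: "v \<in> rows xs" "R v l'"
      then have "v = l'" using Nl'[of v] R_sym[of v l'] xs sub unfolding ps by auto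
      then show False using v assms(7) tV unfolding ps by auto
    qed
    then have "triangular R V (xs @ (s, l') # ys)"
      using tV assms(3,4) R_sym[OF assms(7)] unfolding ps by simp
    then show "(\<exists>z. z \<notin> {l, s} \<and> triangular R V (xs @ (s, z) # ys)) \<or>
          (\<exists>ps'. triangular R V ps' \<and> length ps' = Suc (length ps))"
      using assms(5) by auto
  qed (use assms in auto)
qed auto

text \<open>A self-footprint of \<open>s\<close> can be shifted to \<open>p\<close> unless
  \<open>p\<close> is already dominated; in that case \<open>p\<close> can be played instead of
  \<open>s\<close>.\<close>

lemma balanced_pendant_path:
  assumes "balanced R (V - {l})" "l \<in> V" "s \<in> V" "p \<in> V" "distinct [l, s, p]" "R l s" "R s p"
    and Nl: "\<And>u. u \<in> V \<Longrightarrow> R l u \<Longrightarrow> u = l \<or> u = s"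
    and Np: "\<And>u. u \<in> V \<Longrightarrow> R p u \<Longrightarrow> u = s \<or> u = p \<or> u = q"
  shows "balanced R V"
proof (rule balanced_leaf[OF assms(1,6) Nl])
  fix ps assume t: "triangular R (V - {l}) ps"
  have tV: "triangular R V ps" and sub: "rows ps \<subseteq> V - {l}" "cols ps \<subseteq> V - {l}"
    using triangular_mono[OF t] triangular_subset[OF t] by auto
  show "\<exists>ps'. triangular R V ps' \<and> length ps' = Suc (length ps)"
  proof (rule triangular_insert_leaf[OF t _ _ _ Nl])
    fix xs ys assume ps: "ps = xs @ (s, s) # ys" and xs: "s \<notin> rows xs"
    show "(\<exists>z. z \<notin> {l, s} \<and> triangular R V (xs @ (s, z) # ys)) \<or>
          (\<exists>ps'. triangular R V ps' \<and> length ps' = Suc (length ps))"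
    proof (cases "\<forall>v \<in> rows xs. \<not> R v p")
      case True
      then have "triangular R V (xs @ (s, p) # ys)"
        using tV assms(3,4,7) unfolding ps by simp
      then show ?thesis using assms(5) by auto
    next
      case False
      then obtain v where v: "v \<in> rows xs" "R v p" by blast
      have "v \<noteq> p" using v R_sym[OF assms(7)] tV unfolding ps by auto
      \<comment> \<open>A dominator of \<open>p\<close> is \<open>s\<close>, \<open>p\<close> or
        \<open>q\<close>. As \<open>s\<close> is still undominated, the first two are
        excluded.\<close>
      then have q: "q \<in> rows xs" using v Np[of v] R_sym[of v p] xs sub unfolding ps by auto
      have "\<forall>u \<in> cols ys. \<not> R p u"
      proof -
        have "\<forall>u \<in> cols ys. \<not> R s u \<and> \<not> R q u" "cols ys \<subseteq> V"
          using tV q sub(2) unfolding ps by auto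
        then show ?thesis using Np assms(7) R_refl by blast
      qed
      moreover have "\<forall>u \<in> cols ys. \<not> R l u"
      proof -
        have "\<forall>u \<in> cols ys. \<not> R s u" "cols ys \<subseteq> V - {l}" using tV sub(2) unfolding ps by auto
        then show ?thesis using Nl R_refl by blast
      qed
      moreover have "\<forall>v \<in> rows xs. \<not> R v l"
      proof -
        have "rows xs \<subseteq> V - {l}" using sub(1) unfolding ps by auto
        then show ?thesis using Nl R_sym xs by blast
      qed
      moreover have "\<not> R p l" using Nl[of p] R_sym[of p l] assms(4,5) by auto
      \<comment> \<open>Footprints after \<open>s\<close> are missed by \<open>s\<close> and
        \<open>q\<close>, hence they avoid all of \<open>s\<close>, \<open>p\<close>,
        \<open>q\<close>, the only vertices that \<open>p\<close> dominates. So
        \<open>(s, s)\<close> may become \<open>(p, s), (l, l)\<close>.\<close>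
      ultimately have "triangular R V (xs @ (p, s) # (l, l) # ys)"
        using tV assms(2-4) R_sym[OF assms(7)] unfolding ps by simp
      then show ?thesis unfolding ps by fastforce
    qed
  qed (use assms in auto)
qed auto

text \<open>The two pendant paths pay for the row and the column of \<open>p\<close>, which disconnects all other
  neighbours of \<open>p\<close>.\<close>

lemma balanced_two_pendant_paths:
  assumes bal: "balanced R (V - {l1, s1, l2, s2, p})"
    and V: "l1 \<in> V" "s1 \<in> V" "l2 \<in> V" "s2 \<in> V" "p \<in> V" and d: "distinct [l1, s1, l2, s2, p]"
    and R: "R l1 s1" "R s1 p" "R l2 s2" "R s2 p"
    and Nl1: "\<And>u. u \<in> V \<Longrightarrow> R l1 u \<Longrightarrow> u = l1 \<or> u = s1"
    and Ns1: "\<And>u. u \<in> V \<Longrightarrow> R s1 u \<Longrightarrow> u = l1 \<or> u = s1 \<or> u = p"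
    and Nl2: "\<And>u. u \<in> V \<Longrightarrow> R l2 u \<Longrightarrow> u = l2 \<or> u = s2"
    and Ns2: "\<And>u. u \<in> V \<Longrightarrow> R s2 u \<Longrightarrow> u = l2 \<or> u = s2 \<or> u = p"
  shows "balanced R V"
proof -
  \<comment> \<open>An edge block for each pendant path, and one star each for the row and the
    column of \<open>p\<close>: four blocks for five deleted vertices.\<close>
  let ?D = "[({l1, s1}, {l1, s1}), ({l2, s2}, {l2, s2}), ({p}, {u. R p u}), ({u. R u p}, {p})]"
  show ?thesis
  proof (rule balanced_extend[OF bal, where D = ?D])
    fix ps assume t: "triangular R (V - {l1, s1, l2, s2, p}) ps"
    have tV: "triangular R V ps" and sub: "rows ps \<subseteq> V - {l1, s1, l2, s2, p}" "cols ps \<subseteq> V - {l1, s1, l2, s2, p}"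
      using triangular_mono[OF t] triangular_subset[OF t] by auto
    have "\<forall>u \<in> cols ps. \<not> R l1 u \<and> \<not> R s1 u" using sub Nl1 Ns1 by blast
    moreover have "\<forall>v \<in> rows ps. \<not> R v l2 \<and> \<not> R v s2" using sub Nl2 Ns2 R_sym by blast
    moreover have "\<not> R l1 p" "\<not> R l1 s2" "\<not> R l1 l2" using V d Nl1[of p] Nl1[of s2] Nl1[of l2] by auto
    moreover have "\<not> R s1 s2" "\<not> R s1 l2" using V d Ns1[of s2] Ns1[of l2] by auto
    moreover have "\<not> R p l2" using V d Nl2[of p] R_sym[of p l2] by auto
    \<comment> \<open>Column \<open>p\<close> is used before \<open>ps\<close>, whose moves may
      dominate \<open>p\<close>; row \<open>p\<close> is used after \<open>ps\<close>, whose
      footprints \<open>p\<close> may dominate.\<close>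
    ultimately have "triangular R V ([(l1, l1), (s1, p)] @ ps @ [(p, s2), (l2, l2)])"
      using tV V R R_sym[OF R(4)] by (auto simp: cols_def)
    then show "\<exists>ps'. triangular R V ps' \<and> length ps + length ?D \<le> length ps'"
      by (intro exI conjI, assumption, simp)
  next
    show "\<exists>K\<in>set ?D. a \<in> fst K \<and> b \<in> snd K"
      if "a \<in> V" "b \<in> V" "R a b" "a \<notin> V - {l1, s1, l2, s2, p} \<or> b \<notin> V - {l1, s1, l2, s2, p}" for a b
      using that Nl1[of a] Nl1[of b] Ns1[of a] Ns1[of b] Nl2[of a] Nl2[of b] Ns2[of a] Ns2[of b]
        R_sym[of a b] by auto
  qed (use R R[THEN R_sym] in \<open>auto simp: biclique_def\<close>)
qed

text \<open>Deleting \<open>l\<close> and \<open>s\<close> costs two blocks. Two pairs are gained by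
  replacing at most one pair, with move \<open>m\<close> or \<open>p\<close>, by three pairs; which
  three depends on whether and when \<open>p\<close> and \<open>m\<close> are played.\<close>

lemma balanced_pendant_path_and_leaf:
  assumes bal: "balanced R (V - {l, s})"
    and V: "l \<in> V" "s \<in> V" "p \<in> V" "m \<in> V" and d: "distinct [l, s, p, m]"
    and R: "R l s" "R s p" "R p m"
    and Nl: "\<And>u. u \<in> V \<Longrightarrow> R l u \<Longrightarrow> u = l \<or> u = s"
    and Ns: "\<And>u. u \<in> V \<Longrightarrow> R s u \<Longrightarrow> u = l \<or> u = s \<or> u = p"
    and Nm: "\<And>u. u \<in> V \<Longrightarrow> R m u \<Longrightarrow> u = m \<or> u = p"
    and Np: "\<And>u. u \<in> V \<Longrightarrow> R p u \<Longrightarrow> u = p \<or> u = s \<or> u = m \<or> u = q"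
  shows "balanced R V"
proof -
  let ?D = "[({l, s}, {l, s}), ({s, p}, {s, p})]"
  have nR: "\<not> R l p" "\<not> R p l" "\<not> R l m" "\<not> R m l" "\<not> R s m" "\<not> R m s"
    using V d Nl[of p] Nl[of m] Ns[of m] R_sym[of p l] R_sym[of m l] R_sym[of m s] by auto
  have R': "R m p" "R p s" using R[THEN R_sym] by auto
  show ?thesis
  proof (rule balanced_extend[OF bal, where D = ?D])
    fix ps assume t: "triangular R (V - {l, s}) ps"
    have tV: "triangular R V ps" and sub: "rows ps \<subseteq> V - {l, s}" "cols ps \<subseteq> V - {l, s}"
      using triangular_mono[OF t] triangular_subset[OF t] by auto
    have rl: "\<forall>v \<in> rows ps. \<not> R v l" using sub Nl R_sym by blast
    have rs: "v = p" if "v \<in> rows ps" "R v s" for v using that sub Ns R_sym by blast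
    have rm: "v = m \<or> v = p" if "v \<in> rows ps" "R v m" for v using that sub Nm R_sym by blast
    have cl: "\<forall>u \<in> cols ps. \<not> R l u" using sub Nl by blast
    have cs: "u = p" if "u \<in> cols ps" "R s u" for u using that sub Ns by blast
    have cm: "u = m \<or> u = p" if "u \<in> cols ps" "R m u" for u using that sub Nm by blast
    have "\<exists>ps'. triangular R V ps' \<and> length ps + 2 \<le> length ps'"
    proof (cases "p \<in> rows ps")
      case False
      \<comment> \<open>Dropping the possible pair with move \<open>m\<close> loses at most one;
        afterwards \<open>m\<close>, \<open>s\<close> and \<open>l\<close> are all undominated and
        allow three new pairs at the end.\<close>
      obtain ps0 where ps0: "triangular R V ps0" "rows ps0 \<subseteq> rows ps - {m}" "length ps \<le> Suc (length ps0)"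
      proof (cases "m \<in> rows ps")
        case True
        obtain xs z ys where "ps = xs @ (m, z) # ys" "m \<notin> rows xs" "m \<notin> rows ys"
          using triangular_split_row[OF t True] .
        then show thesis using that[of "xs @ ys"] tV by auto
      next
        case False
        then show thesis using that[of ps] tV by auto
      qed
      have "\<forall>v \<in> rows ps0. \<not> R v m \<and> \<not> R v s \<and> \<not> R v l"
        using rl rs rm ps0(2) False by blast
      then have "triangular R V (ps0 @ [(m, m), (p, s), (l, l)])"
        using ps0(1) V R' nR by auto
      then show ?thesis using ps0(3) by fastforce
    next
      case True
      obtain xs z ys where ps: "ps = xs @ (p, z) # ys" and xs: "p \<notin> rows xs" and ys: "p \<notin> rows ys"
        using triangular_split_row[OF t True] .
      show ?thesis
      proof (cases "m \<in> rows xs")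
        case False
        have "rows xs \<subseteq> rows ps" unfolding ps by auto
        then have "\<forall>v \<in> rows xs. \<not> R v m \<and> \<not> R v s \<and> \<not> R v l"
          using rl rs rm False xs by blast
        moreover have "\<forall>u \<in> cols ys. \<not> R m u \<and> \<not> R l u"
        proof -
          have "\<forall>u \<in> cols ys. \<not> R p u" "cols ys \<subseteq> cols ps" using tV unfolding ps by auto
          then show ?thesis using cm cl R(3) R_refl by blast
        qed
        \<comment> \<open>Before \<open>p\<close> is played, \<open>m\<close>, \<open>s\<close> and
          \<open>l\<close> are undominated, so the pair of \<open>p\<close> can be exchanged for
          three.\<close>
        ultimately have "triangular R V (xs @ [(m, m), (p, s), (l, l)] @ ys)"
          using tV V R' nR unfolding ps by auto
        then show ?thesis unfolding ps by fastforce
      next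
        case True
        have "triangular R V xs" using tV unfolding ps by simp
        then obtain as x bs where as: "xs = as @ (m, x) # bs" and mas: "m \<notin> rows as"
          using triangular_split_row[OF _ True] by metis
        \<comment> \<open>Since \<open>m\<close> dominates \<open>p\<close> and \<open>m\<close>,
          the footprint of \<open>p\<close> can only be \<open>q\<close>. So \<open>q\<close> was
          not played earlier, and \<open>p\<close> is undominated when \<open>m\<close> is played.
          This lets \<open>(l, l), (s, p), (m, m)\<close> replace the pair of
          \<open>m\<close>.\<close>
        have "z \<noteq> p" "z \<noteq> m" using tV R' unfolding ps as by auto
        then have z: "z = q" using Np[of z] tV sub unfolding ps by auto
        have "\<forall>v \<in> rows as. \<not> R v p"
        proof (intro ballI notI)
          fix v assume v: "v \<in> rows as" "R v p"
          then have "v \<noteq> p" "v \<noteq> m" "v \<noteq> q" "v \<noteq> s" "v \<in> V"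
            using xs mas tV sub unfolding ps as z by auto
          then show False using Np[of v] R_sym[OF v(2)] by auto
        qed
        moreover have "\<forall>v \<in> rows as. \<not> R v m \<and> \<not> R v l"
        proof -
          have "rows as \<subseteq> rows ps" "p \<notin> rows as" using xs unfolding ps as by auto
          then show ?thesis using rm rl mas by blast
        qed
        moreover have "\<forall>u \<in> cols bs \<union> {z} \<union> cols ys. \<not> R s u \<and> \<not> R l u"
        proof -
          have "\<forall>u \<in> cols bs \<union> cols ys. \<not> R m u" "cols bs \<union> {z} \<union> cols ys \<subseteq> cols ps"
            using tV unfolding ps as by auto
          then show ?thesis using cs cl R'(1) \<open>z \<noteq> p\<close> by blast
        qed
        ultimately have "triangular R V (as @ [(l, l), (s, p), (m, m)] @ bs @ (p, z) # ys)"
          using tV V R R' nR unfolding ps as by auto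
        then show ?thesis unfolding ps as by (intro exI conjI, assumption, simp)
      qed
    qed
    then show "\<exists>ps'. triangular R V ps' \<and> length ps + length ?D \<le> length ps'" by simp
  next
    show "\<exists>K\<in>set ?D. a \<in> fst K \<and> b \<in> snd K"
      if "a \<in> V" "b \<in> V" "R a b" "a \<notin> V - {l, s} \<or> b \<notin> V - {l, s}" for a b
      using that Nl[of a] Nl[of b] Ns[of a] Ns[of b] R_sym[of a b] by auto
  qed (use R R[THEN R_sym] in \<open>auto simp: biclique_def\<close>)
qed


section \<open>Forests\<close>

text \<open>Forests, since deleting vertices may disconnect a tree. \<open>R\<close> is reflexive,
  so distinctness makes consecutive vertices genuine neighbours; the length bound excludes going
  back along an edge.\<close>

definition forest :: "'a set \<Rightarrow> bool" where
  "forest V \<longleftrightarrow> \<not> (\<exists>xs. set xs \<subseteq> V \<and> distinct xs \<and> 3 \<le> length xs \<and>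
     successively R xs \<and> R (last xs) (hd xs))"

definition path_in :: "'a set \<Rightarrow> 'a list \<Rightarrow> bool" where
  "path_in V xs \<longleftrightarrow> set xs \<subseteq> V \<and> distinct xs \<and> successively R xs"

definition longest_path_in :: "'a set \<Rightarrow> 'a list \<Rightarrow> bool" where
  "longest_path_in V xs \<longleftrightarrow> path_in V xs \<and> (\<forall>ys. path_in V ys \<longrightarrow> length ys \<le> length xs)"

lemma forest_mono: "forest V \<Longrightarrow> W \<subseteq> V \<Longrightarrow> forest W"
  unfolding forest_def by (meson subset_trans)

lemma path_in_Cons [simp]:
  "path_in V (a # xs) \<longleftrightarrow> a \<in> V \<and> a \<notin> set xs \<and> (xs = [] \<or> R a (hd xs)) \<and> path_in V xs"
  by (auto simp: path_in_def successively_Cons)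

text \<open>The chord would close the segment from \<open>a\<close> through \<open>b\<close> to
  \<open>y\<close> into a cycle with at least three vertices.\<close>

lemma forest_no_chord:
  assumes "forest V" "path_in V (a # b # xs)" "y \<in> set xs"
  shows "\<not> R a y"
proof
  assume "R a y"
  obtain us vs where xs: "xs = us @ y # vs" using assms(3) by (meson split_list)
  have p: "path_in V ((a # b # us @ [y]) @ vs)" using assms(2) unfolding xs by simp
  then have "path_in V (a # b # us @ [y])"
    unfolding path_in_def successively_append_iff by auto
  then have "\<exists>zs. set zs \<subseteq> V \<and> distinct zs \<and> 3 \<le> length zs \<and> successively R zs \<and> R (last zs) (hd zs)"
    using R_sym[OF \<open>R a y\<close>] by (intro exI[of _ "a # b # us @ [y]"]) (simp add: path_in_def)
  then show False using assms(1) unfolding forest_def by blast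
qed

lemma longest_path_exists:
  assumes "finite V"
  obtains xs where "longest_path_in V xs"
proof -
  have "length xs \<le> card V" if "path_in V xs" for xs
    using that assms card_mono[of V "set xs"] by (simp add: path_in_def distinct_card)
  then have "\<exists>xs. path_in V xs \<and> (\<forall>ys. path_in V ys \<longrightarrow> length ys \<le> length xs)"
    using ex_has_greatest_nat[of "path_in V" "[]" length "Suc (card V)"]
    by (simp add: path_in_def less_Suc_eq_le)
  then show thesis using that unfolding longest_path_in_def by blast
qed

lemma longest_path_rev:
  assumes "longest_path_in V xs"
  shows "longest_path_in V (rev xs)"
proof -
  have "successively R (rev xs)"
    using assms by (auto simp: longest_path_in_def path_in_def intro: successively_mono R_sym)
  then show ?thesis using assms by (simp add: longest_path_in_def path_in_def)
qed

text \<open>A further neighbour of \<open>a\<close> would be a chord if it lay on the path, and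
  would prolong the path otherwise.\<close>

lemma longest_path_end:
  assumes "forest V" "longest_path_in V (a # b # xs)" "u \<in> V" "R a u"
  shows "u = a \<or> u = b"
proof (rule ccontr)
  assume "\<not> ?thesis"
  moreover have p: "path_in V (a # b # xs)" using assms(2) by (simp add: longest_path_in_def)
  ultimately have "path_in V (u # a # b # xs)"
    using forest_no_chord[OF assms(1) p, of u] assms(3) R_sym[OF assms(4)] assms(4) by auto
  then show False using assms(2) unfolding longest_path_in_def by fastforce
qed

lemma longest_path_exchange:
  assumes "longest_path_in V xs" "path_in V ys" "length ys = length xs"
  shows "longest_path_in V ys"
  using assms unfolding longest_path_in_def by simp

text \<open>On a longest path \<open>l, s, p, q, ...\<close>, twin leaves or a second pendant path
  at \<open>p\<close> finish at once. Otherwise \<open>p\<close> has, besides \<open>s\<close> and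
  \<open>q\<close>, at most one neighbour \<open>m\<close>, a leaf; the cases with and without
  \<open>m\<close> are the last two configurations.\<close>

theorem forest_balanced:
  assumes "finite V" "forest V"
  shows "balanced R V"
  using assms
proof (induction V rule: finite_psubset_induct)
  case (psubset V)
  have IH: "balanced R (V - W)" if "W \<inter> V \<noteq> {}" for W
    using psubset.IH[of "V - W"] that forest_mono[OF psubset.prems] by blast
  obtain xs where long: "longest_path_in V xs" using longest_path_exists[OF psubset.hyps(1)] .
  have twins: "balanced R V" if "l \<in> V" "l' \<in> V" "s \<in> V" "distinct [l, l', s]" "R l s" "R l' s"
    "\<And>u. u \<in> V \<Longrightarrow> R l u \<Longrightarrow> u = l \<or> u = s" "\<And>u. u \<in> V \<Longrightarrow> R l' u \<Longrightarrow> u = l' \<or> u = s" for l l' s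
    using balanced_twin_leaves[OF IH that] that(1) by blast
  consider "xs = []" | v where "xs = [v]" | l s where "xs = [l, s]" | l s p where "xs = [l, s, p]"
    | l s p q rest where "xs = l # s # p # q # rest"
    by (metis list.exhaust)
  then show ?case
  proof cases
    case 1
    have "V = {}"
    proof (rule ccontr)
      assume "V \<noteq> {}"
      then obtain v where "v \<in> V" by blast
      then have "path_in V [v]" by (simp add: path_in_def)
      then show False using long unfolding 1 longest_path_in_def by fastforce
    qed
    then show ?thesis using balanced_empty by simp
  next
    case (2 v)
    have v: "v \<in> V" using long unfolding 2 longest_path_in_def by simp
    have "u = v" if "u \<in> V" "R v u" for u
    proof (rule ccontr)
      assume "u \<noteq> v"
      then have "path_in V [v, u]" using that v by (simp add: path_in_def)
      then show False using long unfolding 2 longest_path_in_def by fastforce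
    qed
    then show ?thesis using balanced_isolated[OF IH v] v by blast
  next
    case (3 l s)
    have p: "l \<in> V" "s \<in> V" "R l s" using long unfolding 3 longest_path_in_def by auto
    \<comment> \<open>The reversed path gives access to the other end, \<open>s\<close>.\<close>
    note long' = longest_path_rev[OF long]
    show ?thesis
    proof (rule balanced_isolated_edge[OF IH p])
      show "u = l \<or> u = s" if "u \<in> V" "R l u" for u
        using longest_path_end[OF psubset.prems long[unfolded 3] that] .
      show "u = l \<or> u = s" if "u \<in> V" "R s u" for u
        using longest_path_end[OF psubset.prems, of s l "[]" u] long' that unfolding 3 by auto
    qed (use p in auto)
  next
    case (4 l s p)
    have V: "l \<in> V" "p \<in> V" "s \<in> V" "distinct [l, p, s]" "R l s" "R p s"
      using long R_sym[of s p] unfolding 4 longest_path_in_def by auto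
    note long' = longest_path_rev[OF long]
    show ?thesis
    proof (rule twins[OF V])
      show "u = l \<or> u = s" if "u \<in> V" "R l u" for u
        using longest_path_end[OF psubset.prems long[unfolded 4] that] .
      show "u = p \<or> u = s" if "u \<in> V" "R p u" for u
        using longest_path_end[OF psubset.prems, of p s "[l]" u] long' that unfolding 4 by auto
    qed
  next
    case (5 l s p q rest)
    note long = long[unfolded 5]
    have path: "path_in V (l # s # p # q # rest)" using long by (simp add: longest_path_in_def)
    have V: "l \<in> V" "s \<in> V" "p \<in> V" "q \<in> V" and R: "R l s" "R s p" "R p q"
      and d: "distinct (l # s # p # q # rest)"
      using path by (auto simp: path_in_def)
    have path2: "path_in V (s # p # q # rest)" and path3: "path_in V (p # q # rest)" using path by auto
    have Nl: "u = l \<or> u = s" if "u \<in> V" "R l u" for u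
      using longest_path_end[OF psubset.prems long that] .
    show ?thesis
    proof (rule ccontr)
      \<comment> \<open>Arguing by contradiction turns each removable configuration into a
        restriction on neighbourhoods.\<close>
      assume unbal: "\<not> balanced R V"
      \<comment> \<open>Another neighbour \<open>u\<close> of \<open>s\<close> could replace
        \<open>l\<close> as end of the longest path, so it would be a leaf, a twin of
        \<open>l\<close>.\<close>
      have Ns: "u = l \<or> u = s \<or> u = p" if u: "u \<in> V" "R s u" for u
      proof (rule ccontr)
        assume neq: "\<not> ?thesis"
        have "u \<notin> set (q # rest)" using forest_no_chord[OF psubset.prems path2, of u] u by auto
        then have "path_in V (u # s # p # q # rest)"
          using neq u R_sym[OF u(2)] path by auto
        then have "longest_path_in V (u # s # p # q # rest)"
          by (rule longest_path_exchange[OF long]) simp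
        note Nu = longest_path_end[OF psubset.prems this]
        have "balanced R V"
          by (rule twins[of l u s]) (use V R u R_sym[OF u(2)] neq d Nl Nu in auto)
        then show False using unbal by simp
      qed
      \<comment> \<open>Every side neighbour \<open>x\<close> of \<open>p\<close> is a leaf. A
        further neighbour \<open>w\<close> of \<open>x\<close> would start another longest path
        through \<open>x\<close> and \<open>p\<close>, hence be a leaf itself.\<close>
      have branch: "v = x \<or> v = p" if x: "x \<in> V" "R p x" "x \<notin> {s, p, q}" and v: "v \<in> V" "R x v" for x v
      proof (rule ccontr)
        assume neq: "\<not> (v = x \<or> v = p)"
        have "x \<notin> set rest" using forest_no_chord[OF psubset.prems path3, of x] x by auto
        then have pathx: "path_in V (x # p # q # rest)"
          using path3 x R_sym[OF x(2)] by auto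
        have longw: "longest_path_in V (w # x # p # q # rest)" if w: "w \<in> V" "R x w" "w \<noteq> x" "w \<noteq> p" for w
        proof (rule longest_path_exchange[OF long])
          have "w \<notin> set (q # rest)" using forest_no_chord[OF psubset.prems pathx, of w] w by auto
          then show "path_in V (w # x # p # q # rest)" using pathx w R_sym[OF w(2)] by auto
        qed simp
        note Nw = longest_path_end[OF psubset.prems longw]
        \<comment> \<open>Two such further neighbours would be twin leaves at \<open>x\<close>, so
          \<open>v\<close> is the only one, and \<open>v, x\<close> is a second pendant path at
          \<open>p\<close>.\<close>
        have Nx: "u = v \<or> u = x \<or> u = p" if u: "u \<in> V" "R x u" for u
        proof (rule ccontr)
          assume nu: "\<not> ?thesis"
          have "balanced R V"
            by (rule twins[of u v x])
              (use x v u nu neq Nw[of u] Nw[of v] R_sym[OF u(2)] R_sym[OF v(2)] in auto)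
          then show False using unbal by simp
        qed
        have Nv: "u = v \<or> u = x" if "u \<in> V" "R v u" for u
          using Nw[of v u] that v neq by auto
        have "x \<noteq> l" using Nl[of p] V d R_sym[OF x(2)] by auto
        moreover have "v \<noteq> l" "v \<noteq> s"
          using Nl[of x] Ns[of x] R_sym[OF v(2)] x \<open>x \<noteq> l\<close> by auto
        ultimately have "balanced R V"
          by (intro balanced_two_pendant_paths[of V l s v x p] IH)
            (use V x v d neq R R_sym[OF x(2)] R_sym[OF v(2)] Nl Ns Nx Nv in auto)
        then show False using unbal by simp
      qed
      \<comment> \<open>By \<open>branch\<close>, two side neighbours of \<open>p\<close> would be
        twin leaves at \<open>p\<close>.\<close>
      have unique: "x = y" if "x \<in> V" "R p x" "x \<notin> {s, p, q}" "y \<in> V" "R p y" "y \<notin> {s, p, q}" for x y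
      proof (rule ccontr)
        assume "x \<noteq> y"
        then have "balanced R V"
          by (intro twins[of x y p])
            (use that V branch[of x] branch[of y] R_sym[OF that(2)] R_sym[OF that(5)] in auto)
        then show False using unbal by simp
      qed
      have "balanced R V"
      proof (cases "\<exists>m \<in> V. R p m \<and> m \<notin> {s, p, q}")
        case False
        then have "u = s \<or> u = p \<or> u = q" if "u \<in> V" "R p u" for u using that by auto
        then show ?thesis
          by (intro balanced_pendant_path[of V l s p q] IH) (use V R d Nl in auto)
      next
        case True
        then obtain m where m: "m \<in> V" "R p m" "m \<notin> {s, p, q}" by blast
        have "m \<noteq> l" using Nl[of p] V d R_sym[OF m(2)] by auto
        moreover have "u = p \<or> u = s \<or> u = m \<or> u = q" if "u \<in> V" "R p u" for u
          using unique[OF that _ m] by auto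
        ultimately show ?thesis
          by (intro balanced_pendant_path_and_leaf[of V l s p m q] IH)
            (use V R d m Nl Ns branch[OF m] in auto)
      qed
      then show False using unbal by simp
    qed
  qed
qed

end

section \<open>Closed neighbourhoods and the strong product\<close>

abbreviation in_nbhd :: "'a pair_pre_digraph \<Rightarrow> 'a \<Rightarrow> 'a \<Rightarrow> bool" where
  "in_nbhd G v u \<equiv> u \<in> closed_nbhd G v"

lemma closed_nbhd_subset:
  assumes "pair_graph G" "v \<in> pverts G"
  shows "closed_nbhd G v \<subseteq> pverts G"
proof -
  interpret pair_graph G by fact
  show ?thesis using assms(2) by (auto simp: closed_nbhd_def intro: in_arcsD2)
qed

lemma closed_adjacency_in_nbhd:
  assumes "pair_graph G"
  shows "closed_adjacency (in_nbhd G)"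
proof -
  interpret pair_graph G by fact
  show ?thesis
    using pair_sym_arcs by unfold_locales (auto simp: closed_nbhd_def symmetric_def sym_def)
qed

text \<open>Including the centre merges the three kinds of adjacency into one conjunction, which
  gives the Kronecker structure.\<close>

lemma closed_nbhd_strong_product:
  assumes "pair_graph G" "pair_graph H" "g \<in> pverts G" "h \<in> pverts H"
  shows "closed_nbhd (strong_product G H) (g, h) = closed_nbhd G g \<times> closed_nbhd H h"
proof -
  have "(g, g') \<in> parcs G \<Longrightarrow> g' \<in> pverts G" for g'
    using closed_nbhd_subset[OF assms(1,3)] by (auto simp: closed_nbhd_def)
  moreover have "(h, h') \<in> parcs H \<Longrightarrow> h' \<in> pverts H" for h'
    using closed_nbhd_subset[OF assms(2,4)] by (auto simp: closed_nbhd_def)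
  ultimately show ?thesis
    using assms(3,4) by (auto simp: closed_nbhd_def strong_product_def)
qed

lemma legal_seq_iff_triangular:
  assumes "pair_graph G"
  shows "legal_seq G S \<longleftrightarrow> (\<exists>ps. triangular (in_nbhd G) (pverts G) ps \<and> S = map fst ps)"
proof
  assume S: "legal_seq G S"
  then have "\<forall>i<length S. \<exists>u. u \<in> closed_nbhd G (S ! i) - (\<Union>j<i. closed_nbhd G (S ! j))"
    unfolding legal_seq_def by blast
  then obtain f where f: "\<And>i. i < length S \<Longrightarrow> f i \<in> closed_nbhd G (S ! i) - (\<Union>j<i. closed_nbhd G (S ! j))"
    by metis
  define ps where "ps = map (\<lambda>i. (S ! i, f i)) [0..<length S]"
  have "S ! i \<in> pverts G" if "i < length S" for i
    using S that nth_mem unfolding legal_seq_def by blast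
  then have "triangular (in_nbhd G) (pverts G) ps"
    using f closed_nbhd_subset[OF assms]
    by (fastforce simp: triangular_def ps_def sorted_wrt_iff_nth_less)
  moreover have "S = map fst ps" by (simp add: ps_def comp_def map_nth)
  ultimately show "\<exists>ps. triangular (in_nbhd G) (pverts G) ps \<and> S = map fst ps" by blast
next
  assume "\<exists>ps. triangular (in_nbhd G) (pverts G) ps \<and> S = map fst ps"
  then obtain ps where t: "triangular (in_nbhd G) (pverts G) ps" and S: "S = map fst ps" by blast
  have "snd (ps ! i) \<in> closed_nbhd G (S ! i) - (\<Union>j<i. closed_nbhd G (S ! j))" if "i < length S" for i
    using t that nth_mem[of i ps]
    by (cases "ps ! i") (fastforce simp: triangular_def S sorted_wrt_iff_nth_less)
  moreover have "set S \<subseteq> pverts G" using t by (auto simp: triangular_def S)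
  ultimately show "legal_seq G S" unfolding legal_seq_def by blast
qed

lemma grundy_dom_number_ge:
  assumes "pair_graph G" "triangular (in_nbhd G) (pverts G) ps"
  shows "length ps \<le> grundy_dom_number G"
proof -
  have "legal_seq G (map fst ps)" using assms legal_seq_iff_triangular by blast
  then have "length (map fst ps) \<in> {length S | S. legal_seq G S}" by blast
  then show ?thesis
    unfolding grundy_dom_number_def using finite_legal_seq_lengths(1)[OF assms(1)] by simp
qed

lemma grundy_dom_number_witness:
  assumes "pair_graph G"
  obtains ps where "triangular (in_nbhd G) (pverts G) ps" "length ps = grundy_dom_number G"
proof -
  obtain S where "legal_seq G S" "length S = grundy_dom_number G"
    using Max_in[OF finite_legal_seq_lengths[OF assms]] unfolding grundy_dom_number_def by auto
  then show thesis using that legal_seq_iff_triangular[OF assms] by auto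
qed

text \<open>In the lexicographic order, pairs from different entries of \<open>ps\<close> are
  separated by \<open>R\<close>, and pairs from the same entry by \<open>Q\<close>.\<close>

lemma triangular_product:
  assumes "triangular R V ps" "triangular Q W qs"
    and P: "\<And>g h x y. g \<in> V \<Longrightarrow> h \<in> W \<Longrightarrow> P (g, h) (x, y) \<longleftrightarrow> R g x \<and> Q h y"
  shows "triangular P (V \<times> W) (concat (map (\<lambda>(g, x). map (\<lambda>(h, y). ((g, h), (x, y))) qs) ps))"
  using assms(1)
proof (induction ps)
  case (Cons p ps)
  obtain g x where p: "p = (g, x)" by fastforce
  have "triangular P (V \<times> W) (map (\<lambda>(h, y). ((g, h), (x, y))) qs)"
    using assms(2) Cons.prems P unfolding triangular_def p
    by (fastforce simp: sorted_wrt_map elim!: sorted_wrt_mono_rel[rotated])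
  moreover have "\<not> P v u" if v: "v \<in> rows (map (\<lambda>(h, y). ((g, h), (x, y))) qs)"
    and u: "u \<in> cols (concat (map (\<lambda>(g, x). map (\<lambda>(h, y). ((g, h), (x, y))) qs) ps))" for v u
  proof -
    obtain h where "v = (g, h)" "h \<in> W"
      using v assms(2) by (fastforce simp: rows_def triangular_def)
    moreover obtain x' y where "u = (x', y)" "x' \<in> cols ps"
      using u by (force simp: cols_def)
    ultimately show ?thesis using Cons.prems P unfolding p by auto
  qed
  ultimately show ?case using Cons unfolding p by simp
qed simp

section \<open>The two bounds for the strong product\<close>

lemma length_eq_sum_filter:
  assumes "finite C" "\<And>p. p \<in> set ps \<Longrightarrow> k p \<in> C"
  shows "length ps = (\<Sum>K\<in>C. length (filter (\<lambda>p. k p = K) ps))"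
  using assms(2)
proof (induction ps)
  case (Cons p ps)
  have "(\<Sum>K\<in>C. length (filter (\<lambda>p. k p = K) (p # ps))) =
      (\<Sum>K\<in>C. (if K = k p then 1 else 0) + length (filter (\<lambda>p. k p = K) ps))"
    by (rule sum.cong) auto
  also have "\<dots> = 1 + length ps"
    using Cons assms(1) by (simp add: sum.distrib)
  finally show ?case by simp
qed simp

text \<open>Moves whose \<open>G\<close>-parts lie in a common biclique are separated by their \<open>H\<close>-parts alone.\<close>

lemma grundy_strong_product_le_cover:
  assumes "pair_graph G" "pair_graph H" "biclique_cover (in_nbhd G) (pverts G) C"
  shows "grundy_dom_number (strong_product G H) \<le> card C * grundy_dom_number H"
proof -
  note P = closed_nbhd_strong_product[OF assms(1,2)]
  have verts: "pverts (strong_product G H) = pverts G \<times> pverts H" by (simp add: strong_product_def)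
  obtain ps where t: "triangular (in_nbhd (strong_product G H)) (pverts G \<times> pverts H) ps"
    and len: "length ps = grundy_dom_number (strong_product G H)"
    using grundy_dom_number_witness[OF pair_graph_strong_product[OF assms(1,2)]] verts by metis
  have mem: "fst (fst p) \<in> pverts G \<and> snd (fst p) \<in> pverts H \<and> fst (snd p) \<in> pverts G \<and>
      snd (snd p) \<in> pverts H \<and> in_nbhd G (fst (fst p)) (fst (snd p)) \<and>
      in_nbhd H (snd (fst p)) (snd (snd p))" if p: "p \<in> set ps" for p
  proof -
    obtain g h x y where "p = ((g, h), (x, y))" by (metis surj_pair)
    then show ?thesis using p t P[of g h] unfolding triangular_def by auto
  qed
  have "\<exists>K\<in>C. fst (fst p) \<in> fst K \<and> fst (snd p) \<in> snd K" if "p \<in> set ps" for p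
    using mem[OF that] assms(3) unfolding biclique_cover_def by blast
  \<comment> \<open>Fixing one block \<open>k p\<close> for each pair partitions the list into
    \<open>card C\<close> classes, some possibly empty.\<close>
  then obtain k where k: "\<And>p. p \<in> set ps \<Longrightarrow> k p \<in> C \<and> fst (fst p) \<in> fst (k p) \<and> fst (snd p) \<in> snd (k p)"
    by metis
  have "length (filter (\<lambda>p. k p = K) ps) \<le> grundy_dom_number H" if "K \<in> C" for K
  proof -
    define qs where "qs = filter (\<lambda>p. k p = K) ps"
    have "sorted_wrt (\<lambda>p q. \<not> in_nbhd (strong_product G H) (fst p) (snd q)) qs"
      using t unfolding triangular_def qs_def by (blast intro: sorted_wrt_filter)
    moreover have "\<not> in_nbhd H (snd (fst p)) (snd (snd q))"
      if "p \<in> set qs" "q \<in> set qs" "\<not> in_nbhd (strong_product G H) (fst p) (snd q)" for p q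
    proof -
      have "fst (fst p) \<in> pverts G" "snd (fst p) \<in> pverts H" using that mem unfolding qs_def by auto
      \<comment> \<open>The row of \<open>p\<close> and the column of \<open>q\<close> lie in the
        same block, so the \<open>G\<close>-parts are always related and the separation must come
        from \<open>H\<close>.\<close>
      moreover have "in_nbhd G (fst (fst p)) (fst (snd q))"
        using that k[of p] k[of q] assms(3) \<open>K \<in> C\<close> unfolding qs_def biclique_cover_def biclique_def by auto
      ultimately show ?thesis
        using that(3) P[of "fst (fst p)" "snd (fst p)"] by (auto simp: mem_Times_iff)
    qed
    ultimately have "sorted_wrt (\<lambda>p q. \<not> in_nbhd H (snd (fst p)) (snd (snd q))) qs"
      by (rule sorted_wrt_mono_rel[rotated])
    moreover have "\<forall>p \<in> set qs. snd (fst p) \<in> pverts H \<and> snd (snd p) \<in> pverts H \<and>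
        in_nbhd H (snd (fst p)) (snd (snd p))"
      using mem unfolding qs_def by simp
    ultimately have "triangular (in_nbhd H) (pverts H) (map (\<lambda>p. (snd (fst p), snd (snd p))) qs)"
      by (simp add: triangular_def sorted_wrt_map)
    then show ?thesis using grundy_dom_number_ge[OF assms(2)] unfolding qs_def by fastforce
  qed
  then have "length ps \<le> (\<Sum>K\<in>C. grundy_dom_number H)"
    using length_eq_sum_filter[of C ps k] k assms(3) unfolding biclique_cover_def
    by (metis (no_types, lifting) sum_mono)
  then show ?thesis using len by simp
qed

lemma grundy_strong_product_ge:
  assumes "pair_graph G" "pair_graph H"
  shows "grundy_dom_number G * grundy_dom_number H \<le> grundy_dom_number (strong_product G H)"
proof -
  obtain ps where ps: "triangular (in_nbhd G) (pverts G) ps" "length ps = grundy_dom_number G"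
    using grundy_dom_number_witness[OF assms(1)] .
  obtain qs where qs: "triangular (in_nbhd H) (pverts H) qs" "length qs = grundy_dom_number H"
    using grundy_dom_number_witness[OF assms(2)] .
  let ?rs = "concat (map (\<lambda>(g, x). map (\<lambda>(h, y). ((g, h), (x, y))) qs) ps)"
  have "triangular (in_nbhd (strong_product G H)) (pverts G \<times> pverts H) ?rs"
    using ps(1) qs(1) by (rule triangular_product) (simp add: closed_nbhd_strong_product[OF assms])
  then have "triangular (in_nbhd (strong_product G H)) (pverts (strong_product G H)) ?rs"
    by (simp add: strong_product_def)
  then have "length ?rs \<le> grundy_dom_number (strong_product G H)"
    using grundy_dom_number_ge[OF pair_graph_strong_product[OF assms]] by blast
  moreover have "length ?rs = length ps * length qs"
    by (induction ps) auto
  ultimately show ?thesis using ps(2) qs(2) by simp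
qed

section \<open>From undirected trees to forests\<close>

lemma pawalk_verts_vwalk_arcs: "pawalk_verts u (vwalk_arcs (u # xs)) = u # xs"
  by (induction xs arbitrary: u) auto

lemma pcas_vwalk_arcs: "pcas u (vwalk_arcs (u # xs)) (last (u # xs))"
  by (induction xs arbitrary: u) auto

lemma set_vwalk_arcs_subset:
  "successively (\<lambda>x y. (x, y) \<in> A) xs \<Longrightarrow> set (vwalk_arcs xs) \<subseteq> A"
  by (induction xs rule: vwalk_arcs.induct) auto

lemma forest_if_undirected_tree:
  assumes "pair_graph G" "undirected_tree G"
  shows "closed_adjacency.forest (in_nbhd G) (pverts G)"
proof -
  interpret closed_adjacency "in_nbhd G" by (rule closed_adjacency_in_nbhd[OF assms(1)])
  show ?thesis
    unfolding forest_def
  proof (intro notI, elim exE conjE)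
    fix xs
    assume xs: "set xs \<subseteq> pverts G" "distinct xs" "3 \<le> length xs"
      and succ: "successively (in_nbhd G) xs" and cl: "in_nbhd G (last xs) (hd xs)"
    have "xs \<noteq> []" using xs(3) by auto
    \<comment> \<open>Prefixing the last vertex closes the walk: its vertex list is
      \<open>u # xs\<close>, whose tail \<open>xs\<close> is distinct as \<open>cycle\<close>
      demands, and it has \<open>length xs\<close> arcs.\<close>
    define u where "u = last xs"
    define p where "p = vwalk_arcs (u # xs)"
    have "successively (\<lambda>x y. (x, y) \<in> parcs G) xs"
      using succ xs(2)
      by (induction xs rule: induct_list012) (auto simp: closed_nbhd_def)
    moreover have "(u, hd xs) \<in> parcs G"
    proof -
      \<comment> \<open>The first and last vertices differ, so the closing pair is an arc and not
        the reflexive case of \<open>in_nbhd\<close>.\<close>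
      obtain a b ys where "xs = a # b # ys" using xs(3)
        by (metis Suc_le_length_iff numeral_3_eq_3)
      then have "u \<noteq> hd xs" using xs(2) unfolding u_def by auto
      then show ?thesis using cl unfolding u_def closed_nbhd_def by auto
    qed
    ultimately have "set p \<subseteq> parcs G"
      unfolding p_def by (intro set_vwalk_arcs_subset) (simp add: successively_Cons)
    moreover have "u \<in> pverts G" using xs(1) \<open>xs \<noteq> []\<close> unfolding u_def by auto
    moreover have "pcas u p u" using pcas_vwalk_arcs[of u xs] \<open>xs \<noteq> []\<close> unfolding p_def u_def by simp
    ultimately have "pre_digraph.awalk (with_proj G) u p u"
      unfolding pre_digraph.awalk_def by (simp add: cas_with_proj_eq)
    moreover have "distinct (tl (pre_digraph.awalk_verts (with_proj G) u p))"
      using xs(2) unfolding awalk_verts_with_proj_eq p_def pawalk_verts_vwalk_arcs by simp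
    moreover have "length p = length xs"
      using vwalk_length_simp[of "u # xs"] unfolding vwalk_length_def p_def by simp
    ultimately have "pre_digraph.cycle (with_proj G) p \<and> 3 \<le> length p"
      unfolding pre_digraph.cycle_def using xs(3) by auto
    then show False using assms(2) unfolding undirected_tree_def by blast
  qed
qed

theorem theorem4p2:
  fixes G :: "'a pair_pre_digraph" and H :: "'b pair_pre_digraph"
  assumes "pair_graph G" and "undirected_tree G"
    and "pair_graph H"
  shows "grundy_dom_number (strong_product G H) = grundy_dom_number G * grundy_dom_number H"
proof (rule antisym)
  interpret G: pair_graph G by fact
  have "finite (pverts G)" by (rule G.pair_finite_verts)
  then have "balanced (in_nbhd G) (pverts G)"
    using closed_adjacency.forest_balanced[OF closed_adjacency_in_nbhd] forest_if_undirected_tree assms(1,2)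
    by blast
  then obtain ps C where "triangular (in_nbhd G) (pverts G) ps"
    and C: "biclique_cover (in_nbhd G) (pverts G) C" and "card C \<le> length ps"
    unfolding balanced_def by blast
  \<comment> \<open>The triangular list bounds the number of blocks by the Grundy domination number
    of \<open>G\<close>.\<close>
  then have "card C \<le> grundy_dom_number G"
    using grundy_dom_number_ge[OF assms(1)] le_trans by blast
  then show "grundy_dom_number (strong_product G H) \<le> grundy_dom_number G * grundy_dom_number H"
    using grundy_strong_product_le_cover[OF assms(1,3) C] by (meson le_trans mult_le_mono1)
  show "grundy_dom_number G * grundy_dom_number H \<le> grundy_dom_number (strong_product G H)"
    using grundy_strong_product_ge[OF assms(1,3)] .
qed

end
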